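(* Consider a plant $P$ and let $\hat M$ be the corresponding finite state machine, both as described in the context, for some choice of integer $n>0$ and admissible angles $\alpha_1,\dots,\alpha_{2n+1}$. If $q(0)=q_o$, then for any input $\mathbf u\in\mathcal U^{\mathbb Z_+}$ and for any initial condition of $P$, the outputs $\mathbf{\hat v}\in\mathcal V^{\mathbb Z_+}$ of $(M,\Delta)$ and $\mathbf v\in\mathbb R^{\mathbb Z_+}$ of $P$ satisfy $$\hat v(t)\ge v(t)\quad\text{for all } t\in\mathbb Z_+ .$$
   Context: **Plant.** $\mathbb Z_+$ is the set of non-negative integers, $\mathcal U=\{0,1\}$, $\mathcal Y=\{-1,1\}$, $\mathcal W=\{0,1\}$; for a set $A$, $A^{\mathbb Z_+}$ is the set of infinite sequences in $A$. The plant $P$ is the discrete-time system $$x(t+1)=f_{u(t)}(x(t)),\quad y(t)=\mathrm{sign}(c'x(t)),\quad v(t)=\log\Big(\frac{\|x(t+1)\|}{\|x(t)\|}\Big),$$ with $t\in\mathbb Z_+$, state $x(t)\in\mathbb R^2$, performance output $v(t)\in\mathbb R$, control input $u(t)\in\mathcal U$ and sensor output $y(t)\in\mathcal Y$, with the understanding that when $c'x=0$, $y$ is taken to be $+1$ in one quadrant and $-1$ in the other. Here $\|\cdot\|$ is the Euclidean norm, and the functions $f_u=(f_{u1},f_{u2})':\mathbb R^2\to\mathbb R^2$ and the vector $c=(c_1,c_2)'\in\mathbb R^2$, $c\ne0$, are given. For each $u\in\{0,1\}$, $f_u$ is continuous and homogeneous with degree 1, i.e. $f_u(\alpha x)=\alpha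 f_u(x)$ for all $\alpha\in\mathbb R$, $x\in\mathbb R^2$. With $\beta(\theta)=(\cos\theta,\sin\theta)'$ and polar coordinates $r=\|x\|$, $\theta=\tan^{-1}(x_2/x_1)$ (the polar angle of $x$), the plant satisfies $\theta(t+1)=\tan^{-1}\Big(\frac{f_{u(t)2}(\beta(\theta(t)))}{f_{u(t)1}(\beta(\theta(t)))}\Big)$, $y(t)=\mathrm{sign}(c'\beta(\theta(t)))$ and $v(t)=\log\|f_{u(t)}(\beta(\theta(t)))\|$. **Partition and potential states.** The unit circle is partitioned into intervals $I_1,\dots,I_{2n}$, $I_i=[\alpha_i,\alpha_{i+1})$, for angles $\alpha_1<\dots<\alpha_{2n+1}$ that are admissible, i.e. $\alpha_1=\tan^{-1}(-c_1/c_2)$ with $\alpha_1\in[0,\pi)$, $\alpha_{n+1}=\alpha_1+\pi$, $\alpha_{2n+1}=\alpha_1+2\pi$. The partition is to be such that the outputs $y$ associated with all states of $P$ whose angular coordinates lie in any given interval are identical. The set of potential states is $\hat{\mathcal Q}=S_1\cup S_2\cup\dots\cup S_{2n}$, where $S_k$ is the set of all unions of $k$ (cyclically) adjacent intervals: $S_1=\{I_1,\dots,I_{2n}\}$, $S_2=\{I_1\cup I_2,I_2\cup I_3,\dots,I_{2n}\cup I_1\}$, ..., $S_{2n}=\{I_1\cup\dots\cup I_{2n}\}$; it has $2n(2n-1)+1$ distinct elements. Let $q_o=[\alpha_1,\alpha_{2n+1})$ be the state corresponding to the whole unit circle. For $q\in\hat{\mathcal Q}$, let $$\mathcal P_1(q)=\begin{cases}q\cap[\alpha_1,\alpha_{n+1})&\text{if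 }\mathrm{sign}(c'\beta(\alpha_2))=1\\ q\cap[\alpha_{n+1},\alpha_{2n+1})&\text{otherwise}\end{cases}\qquad \mathcal P_{-1}(q)=\begin{cases}q\cap[\alpha_1,\alpha_{n+1})&\text{if }\mathrm{sign}(c'\beta(\alpha_2))=-1\\ q\cap[\alpha_{n+1},\alpha_{2n+1})&\text{otherwise}\end{cases}$$ It is asserted as part of the construction that $\mathcal P_1(q),\mathcal P_{-1}(q)\in\hat{\mathcal Q}$. For $u\in\mathcal U$, $q\in\hat{\mathcal Q}$, let $q_+^u=\tan^{-1}\Big(\frac{f_{u2}(\beta(q))}{f_{u1}(\beta(q))}\Big)$ (the set of polar angles of $f_u(\beta(\theta))$, $\theta\in q$) and $\mathcal I_q^u=\{i\in\{1,\dots,2n\}: q_+^u\cap[\alpha_i,\alpha_{i+1})\neq\emptyset\}$. **The machine $\hat M$.** It has inputs $u\in\mathcal U$, $\tilde y\in\mathcal Y$, state $q\in\hat{\mathcal Q}$ and dynamics $$q(t+1)=\hat f(q(t),u(t),\tilde y(t)),\quad \hat y(t)=\hat g(q(t)),\quad \hat v(t)=\hat h(q(t),u(t)),$$ with $\hat f:\hat{\mathcal Q}\times\mathcal U\times\mathcal Y\to\hat{\mathcal Q}$, $\hat g:\hat{\mathcal Q}\to\mathcal Y$, $\hat h:\hat{\mathcal Q}\times\mathcal U\to\mathcal V$ ($\mathcal V$ a finite subset of $\mathbb R$) defined by $$\hat f(q,u,\tilde y)=\bigcup_{i\in\mathcal I^u_{\mathcal P_{\tilde y}(q)}}[\alpha_i,\alpha_{i+1}),\qquad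 \hat h(q,u)=\sup_{\theta\in q}\log\big(\|f_u(\beta(\theta))\|\big),$$ $$\hat g(q)=\begin{cases}1&\text{if } q=\mathcal P_1(q)\text{ or }|\mathcal P_1(q)|\ge|\mathcal P_{-1}(q)|\\-1&\text{if } q=\mathcal P_{-1}(q)\text{ or }|\mathcal P_1(q)|<|\mathcal P_{-1}(q)|\end{cases}$$ where $|\cdot|$ denotes length of an interval. **Systems $M$ and $\Delta$.** $M$ has inputs $u\in\mathcal U$, $w\in\mathcal W$; it contains a copy of $\hat M$ driven by $u$ and $\tilde y$, where $\tilde y=\hat y$ if $w=0$ and $\tilde y=-\hat y$ if $w=1$, $\hat y$ being the output of this copy; its outputs are $u$, $\tilde y$ and the output $\hat v$ of this copy. $\Delta$ has input $u$ and output $w$; it contains $P$ driven by $u$, with output $y$, and a copy of $\hat M$ driven by $u$ and $y$ (in place of $\tilde y$), with output $\hat y$; $w=0$ if $y=\hat y$ and $w=1$ if $y\ne\hat y$. In the interconnection $(M,\Delta)$ the same $u$ drives $M$ and $\Delta$, the output $w$ of $\Delta$ is the input $w$ of $M$, and the two copies of $\hat M$ are identically initialized; $q(0)$ is their initial state. The outputs of $(M,\Delta)$ and $P$ are compared under the same input $\mathbf u$, with $P$ and the copy of $P$ in $\Delta$ having the same initial condition. *)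

theory Defs
  imports "HOL-Analysis.Analysis"
begin

text \<open>Controls and the signal \<open>w\<close> are natural numbers in \<open>{0, 1}\<close>; sensor values are integers
  in \<open>{-1, 1}\<close>.\<close>

text \<open>The logarithm takes values in \<^typ>\<open>ereal\<close> with \<open>log 0 = -\<infinity>\<close>. The library convention
  \<open>ln 0 = 0\<close> would corrupt the suprema below whenever some \<open>f u\<close> vanishes at a unit vector;
  away from such points the values are real, see \<open>perf_real\<close> and \<open>hhat_real\<close>.\<close>

definition elog :: "real \<Rightarrow> ereal" where
  "elog r = (if 0 < r then ereal (ln r) else - \<infinity>)"

text \<open>The sensor is \<open>sign (c' x)\<close>; on the line \<open>c' x = 0\<close> it is \<open>1\<close> on one of the two open rays and
  \<open>-1\<close> on the opposite one. Its value at \<open>x = 0\<close> is not prescribed.\<close>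

definition sensor :: "real ^ 2 \<Rightarrow> (real ^ 2 \<Rightarrow> int) \<Rightarrow> bool" where
  "sensor c s \<longleftrightarrow>
     (\<forall>x. s x \<in> {-1, 1}) \<and>
     (\<forall>x. c \<bullet> x \<noteq> 0 \<longrightarrow> real_of_int (s x) = sgn (c \<bullet> x)) \<and>
     (\<exists>d. d \<noteq> 0 \<and> c \<bullet> d = 0 \<and> (\<forall>a>0. s (a *\<^sub>R d) = 1 \<and> s (- (a *\<^sub>R d)) = -1))"

definition plant :: "(nat \<Rightarrow> real ^ 2 \<Rightarrow> real ^ 2) \<Rightarrow> real ^ 2 \<Rightarrow> (real ^ 2 \<Rightarrow> int) \<Rightarrow> bool" where
  "plant f c s \<longleftrightarrow>
     c \<noteq> 0 \<and> sensor c s \<and>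
     (\<forall>u\<in>{0, 1}. continuous_on UNIV (f u) \<and> (\<forall>a x. f u (a *\<^sub>R x) = a *\<^sub>R f u x))"

primrec plant_state ::
  "(nat \<Rightarrow> real ^ 2 \<Rightarrow> real ^ 2) \<Rightarrow> real ^ 2 \<Rightarrow> (nat \<Rightarrow> nat) \<Rightarrow> nat \<Rightarrow> real ^ 2" where
  "plant_state f x0 u 0 = x0"
| "plant_state f x0 u (Suc t) = f (u t) (plant_state f x0 u t)"

text \<open>The performance output \<open>v\<close>. It is only meaningful while \<open>x(t) \<noteq> 0\<close>; as \<open>0 / 0 = 0\<close> it is
  \<open>-\<infinity>\<close> otherwise.\<close>

definition perf ::
  "(nat \<Rightarrow> real ^ 2 \<Rightarrow> real ^ 2) \<Rightarrow> real ^ 2 \<Rightarrow> (nat \<Rightarrow> nat) \<Rightarrow> nat \<Rightarrow> ereal" where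
  "perf f x0 u t = elog (norm (plant_state f x0 u (Suc t)) / norm (plant_state f x0 u t))"

lemma perf_real:
  assumes "plant_state f x0 u t \<noteq> 0" "plant_state f x0 u (Suc t) \<noteq> 0"
  shows "perf f x0 u t =
    ereal (ln (norm (plant_state f x0 u (Suc t)) / norm (plant_state f x0 u t)))"
  using assms by (simp add: perf_def elog_def)

definition beta :: "real \<Rightarrow> real ^ 2" where
  "beta \<theta> = vector [cos \<theta>, sin \<theta>]"

text \<open>Polar angles are a relation: all representatives modulo \<open>2\<pi>\<close> are admitted, so that no
  branch of the inverse tangent has to be chosen. The zero vector has no polar angle.\<close>

definition polar_angle :: "real ^ 2 \<Rightarrow> real \<Rightarrow> bool" where
  "polar_angle x \<theta> \<longleftrightarrow> x \<noteq> 0 \<and> x = norm x *\<^sub>R beta \<theta>"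

text \<open>The value of \<open>arctan (- c\<^sub>1 / c\<^sub>2)\<close> in \<open>[0, \<pi>)\<close>, read as \<open>\<pi>/2\<close> when \<open>c\<^sub>2 = 0\<close>.\<close>

definition line_angle :: "real ^ 2 \<Rightarrow> real" where
  "line_angle c =
     (if c $ 2 = 0 then pi / 2
      else if 0 \<le> arctan (- c $ 1 / c $ 2) then arctan (- c $ 1 / c $ 2)
      else arctan (- c $ 1 / c $ 2) + pi)"

lemma line_angle_props:
  "0 \<le> line_angle c" "line_angle c < pi" "c \<bullet> beta (line_angle c) = 0"
proof -
  have b: "- (pi / 2) < arctan z" "arctan z < pi / 2" for z
    using arctan_bounded by auto
  show "0 \<le> line_angle c" "line_angle c < pi"
    using b[of "- c $ 1 / c $ 2"] by (auto simp: line_angle_def)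
  have *: "c $ 1 * cos (arctan z) + c $ 2 * sin (arctan z) = 0"
    if "c $ 2 \<noteq> 0" "z = - c $ 1 / c $ 2" for z
  proof -
    have "sin (arctan z) = z * cos (arctan z)"
      using cos_arctan_not_zero[of z] tan_arctan[of z] by (simp add: tan_def field_simps)
    then show ?thesis using that by simp
  qed
  show "c \<bullet> beta (line_angle c) = 0"
    using *[of "- c $ 1 / c $ 2"]
    by (auto simp: line_angle_def beta_def inner_vec_def sum_2)
qed

definition admissible :: "real ^ 2 \<Rightarrow> nat \<Rightarrow> (nat \<Rightarrow> real) \<Rightarrow> bool" where
  "admissible c n \<alpha> \<longleftrightarrow>
     (\<forall>i\<in>{1..2*n}. \<alpha> i < \<alpha> (i + 1)) \<and>
     \<alpha> 1 = line_angle c \<and> \<alpha> (n + 1) = \<alpha> 1 + pi \<and> \<alpha> (2*n + 1) = \<alpha> 1 + 2 * pi"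

definition cell :: "(nat \<Rightarrow> real) \<Rightarrow> nat \<Rightarrow> real set" where
  "cell \<alpha> i = {\<alpha> i ..< \<alpha> (i + 1)}"

definition output_partition :: "(real ^ 2 \<Rightarrow> int) \<Rightarrow> nat \<Rightarrow> (nat \<Rightarrow> real) \<Rightarrow> bool" where
  "output_partition s n \<alpha> \<longleftrightarrow>
     (\<forall>i\<in>{1..2*n}. \<forall>x x' \<theta> \<theta>'.
        polar_angle x \<theta> \<longrightarrow> \<theta> \<in> cell \<alpha> i \<longrightarrow> polar_angle x' \<theta>' \<longrightarrow> \<theta>' \<in> cell \<alpha> i \<longrightarrow> s x = s x')"

definition potential_states :: "nat \<Rightarrow> (nat \<Rightarrow> real) \<Rightarrow> real set set" where
  "potential_states n \<alpha> =
     {\<Union>j\<in>{..<k}. cell \<alpha> ((i + j) mod (2*n) + 1) | i k. i < 2*n \<and> k \<in> {1..2*n}}"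

definition full_state :: "nat \<Rightarrow> (nat \<Rightarrow> real) \<Rightarrow> real set" where
  "full_state n \<alpha> = {\<alpha> 1 ..< \<alpha> (2*n + 1)}"

text \<open>\<open>half_part s n \<alpha> y\<close> is \<open>\<P>\<^sub>y\<close> for \<open>y \<in> {-1, 1}\<close>. The sign of \<open>c' \<beta>(\<alpha>\<^sub>2)\<close> is the sensor
  value, because \<open>c' \<beta>(\<alpha>\<^sub>2) = 0\<close> when \<open>n = 1\<close>.\<close>

definition half_part ::
  "(real ^ 2 \<Rightarrow> int) \<Rightarrow> nat \<Rightarrow> (nat \<Rightarrow> real) \<Rightarrow> int \<Rightarrow> real set \<Rightarrow> real set" where
  "half_part s n \<alpha> y q =
     (if s (beta (\<alpha> 2)) = y then q \<inter> {\<alpha> 1 ..< \<alpha> (n + 1)}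
      else q \<inter> {\<alpha> (n + 1) ..< \<alpha> (2*n + 1)})"

definition image_angles :: "(nat \<Rightarrow> real ^ 2 \<Rightarrow> real ^ 2) \<Rightarrow> nat \<Rightarrow> real set \<Rightarrow> real set" where
  "image_angles f u q = {\<phi>. \<exists>\<theta>\<in>q. polar_angle (f u (beta \<theta>)) \<phi>}"

definition hit_cells ::
  "(nat \<Rightarrow> real ^ 2 \<Rightarrow> real ^ 2) \<Rightarrow> nat \<Rightarrow> (nat \<Rightarrow> real) \<Rightarrow> nat \<Rightarrow> real set \<Rightarrow> nat set" where
  "hit_cells f n \<alpha> u q = {i\<in>{1..2*n}. image_angles f u q \<inter> cell \<alpha> i \<noteq> {}}"

text \<open>The machine maps are defined for all sets of angles, not only for members of
  \<open>potential_states n \<alpha>\<close>: by \<open>half_part_not_closed\<close> below, \<open>\<P>\<^sub>y\<close> does not map potential states to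
  potential states.\<close>

definition fhat ::
  "(nat \<Rightarrow> real ^ 2 \<Rightarrow> real ^ 2) \<Rightarrow> (real ^ 2 \<Rightarrow> int) \<Rightarrow> nat \<Rightarrow> (nat \<Rightarrow> real)
    \<Rightarrow> real set \<Rightarrow> nat \<Rightarrow> int \<Rightarrow> real set" where
  "fhat f s n \<alpha> q u y = (\<Union>i\<in>hit_cells f n \<alpha> u (half_part s n \<alpha> y q). cell \<alpha> i)"

text \<open>Length is Lebesgue measure, since \<open>\<P>\<^sub>y(q)\<close> need not be connected. The two cases in the
  definition of \<open>ghat\<close> are complementary for every potential state, see \<open>ghat_minus_one\<close>.\<close>

definition ghat ::
  "(real ^ 2 \<Rightarrow> int) \<Rightarrow> nat \<Rightarrow> (nat \<Rightarrow> real) \<Rightarrow> real set \<Rightarrow> int" where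
  "ghat s n \<alpha> q =
     (if q = half_part s n \<alpha> 1 q \<or>
         measure lborel (half_part s n \<alpha> 1 q) \<ge> measure lborel (half_part s n \<alpha> (-1) q)
      then 1 else -1)"

definition hhat :: "(nat \<Rightarrow> real ^ 2 \<Rightarrow> real ^ 2) \<Rightarrow> real set \<Rightarrow> nat \<Rightarrow> ereal" where
  "hhat f q u = (SUP \<theta>\<in>q. elog (norm (f u (beta \<theta>))))"

primrec mhat_state ::
  "(nat \<Rightarrow> real ^ 2 \<Rightarrow> real ^ 2) \<Rightarrow> (real ^ 2 \<Rightarrow> int) \<Rightarrow> nat \<Rightarrow> (nat \<Rightarrow> real)
    \<Rightarrow> real set \<Rightarrow> (nat \<Rightarrow> nat) \<Rightarrow> (nat \<Rightarrow> int) \<Rightarrow> nat \<Rightarrow> real set" where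
  "mhat_state f s n \<alpha> q0 u y 0 = q0"
| "mhat_state f s n \<alpha> q0 u y (Suc t) = fhat f s n \<alpha> (mhat_state f s n \<alpha> q0 u y t) (u t) (y t)"

text \<open>\<open>delta_out\<close> is the output \<open>w\<close> of \<open>\<Delta>\<close>; \<open>M_state\<close>, \<open>M_ytilde\<close> and \<open>M_vhat\<close> are the state and
  outputs of \<open>M\<close> for given input signals \<open>u\<close> and \<open>w\<close>.\<close>

definition delta_out ::
  "(nat \<Rightarrow> real ^ 2 \<Rightarrow> real ^ 2) \<Rightarrow> (real ^ 2 \<Rightarrow> int) \<Rightarrow> nat \<Rightarrow> (nat \<Rightarrow> real)
    \<Rightarrow> real ^ 2 \<Rightarrow> real set \<Rightarrow> (nat \<Rightarrow> nat) \<Rightarrow> nat \<Rightarrow> nat" where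
  "delta_out f s n \<alpha> x0 q0 u t =
     (let y = (\<lambda>t. s (plant_state f x0 u t)) in
      if y t = ghat s n \<alpha> (mhat_state f s n \<alpha> q0 u y t) then 0 else 1)"

definition flip_by :: "nat \<Rightarrow> int \<Rightarrow> int" where
  "flip_by w y = (if w = 0 then y else - y)"

primrec M_state ::
  "(nat \<Rightarrow> real ^ 2 \<Rightarrow> real ^ 2) \<Rightarrow> (real ^ 2 \<Rightarrow> int) \<Rightarrow> nat \<Rightarrow> (nat \<Rightarrow> real)
    \<Rightarrow> real set \<Rightarrow> (nat \<Rightarrow> nat) \<Rightarrow> (nat \<Rightarrow> nat) \<Rightarrow> nat \<Rightarrow> real set" where
  "M_state f s n \<alpha> q0 u w 0 = q0"
| "M_state f s n \<alpha> q0 u w (Suc t) =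
     fhat f s n \<alpha> (M_state f s n \<alpha> q0 u w t) (u t)
       (flip_by (w t) (ghat s n \<alpha> (M_state f s n \<alpha> q0 u w t)))"

definition M_ytilde ::
  "(nat \<Rightarrow> real ^ 2 \<Rightarrow> real ^ 2) \<Rightarrow> (real ^ 2 \<Rightarrow> int) \<Rightarrow> nat \<Rightarrow> (nat \<Rightarrow> real)
    \<Rightarrow> real set \<Rightarrow> (nat \<Rightarrow> nat) \<Rightarrow> (nat \<Rightarrow> nat) \<Rightarrow> nat \<Rightarrow> int" where
  "M_ytilde f s n \<alpha> q0 u w t = flip_by (w t) (ghat s n \<alpha> (M_state f s n \<alpha> q0 u w t))"

definition M_vhat ::
  "(nat \<Rightarrow> real ^ 2 \<Rightarrow> real ^ 2) \<Rightarrow> (real ^ 2 \<Rightarrow> int) \<Rightarrow> nat \<Rightarrow> (nat \<Rightarrow> real)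
    \<Rightarrow> real set \<Rightarrow> (nat \<Rightarrow> nat) \<Rightarrow> (nat \<Rightarrow> nat) \<Rightarrow> nat \<Rightarrow> ereal" where
  "M_vhat f s n \<alpha> q0 u w t = hhat f (M_state f s n \<alpha> q0 u w t) (u t)"

text \<open>The output \<open>vhat\<close> of the interconnection: \<open>M\<close> driven by \<open>u\<close> and by the output of \<open>\<Delta>\<close>, with
  both copies of the machine started in \<open>q0\<close>.\<close>

definition M_Delta_vhat ::
  "(nat \<Rightarrow> real ^ 2 \<Rightarrow> real ^ 2) \<Rightarrow> (real ^ 2 \<Rightarrow> int) \<Rightarrow> nat \<Rightarrow> (nat \<Rightarrow> real)
    \<Rightarrow> real ^ 2 \<Rightarrow> real set \<Rightarrow> (nat \<Rightarrow> nat) \<Rightarrow> nat \<Rightarrow> ereal" where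
  "M_Delta_vhat f s n \<alpha> x0 q0 u = M_vhat f s n \<alpha> q0 u (delta_out f s n \<alpha> x0 q0 u)"

lemma admissible_strict_mono:
  assumes "admissible c n \<alpha>" "1 \<le> i" "i < j" "j \<le> 2*n + 1"
  shows "\<alpha> i < \<alpha> j"
  using assms(3,4)
proof (induction j)
  case (Suc j)
  have "\<alpha> j < \<alpha> (Suc j)" if "1 \<le> j"
    using assms(1) that Suc.prems by (auto simp: admissible_def)
  with Suc assms(2) show ?case
    by (cases "i = j") (auto intro: less_trans)
qed simp

lemma admissible_mono:
  assumes "admissible c n \<alpha>" "1 \<le> i" "i \<le> j" "j \<le> 2*n + 1"
  shows "\<alpha> i \<le> \<alpha> j"
  using admissible_strict_mono[OF assms(1,2) _ assms(4)] assms(3) by (cases "i = j") auto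

lemma Union_cells:
  assumes "admissible c n \<alpha>" "k \<le> 2*n"
  shows "(\<Union>j\<in>{..<k}. cell \<alpha> (j + 1)) = {\<alpha> 1 ..< \<alpha> (k + 1)}"
  using assms(2)
proof (induction k)
  case (Suc k)
  have "\<alpha> 1 \<le> \<alpha> (k + 1)" "\<alpha> (k + 1) \<le> \<alpha> (k + 2)"
    using Suc.prems by (auto intro!: admissible_mono[OF assms(1)])
  then have "{\<alpha> 1 ..< \<alpha> (k + 1)} \<union> cell \<alpha> (k + 1) = {\<alpha> 1 ..< \<alpha> (Suc k + 1)}"
    by (auto simp: cell_def)
  with Suc show ?case by (simp add: lessThan_Suc Un_commute)
qed simp

lemma full_state_potential:
  assumes "admissible c n \<alpha>" "0 < n"
  shows "full_state n \<alpha> \<in> potential_states n \<alpha>"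
proof -
  have "(\<Union>j\<in>{..<2*n}. cell \<alpha> ((0 + j) mod (2*n) + 1)) = (\<Union>j\<in>{..<2*n}. cell \<alpha> (j + 1))"
    by (intro SUP_cong) auto
  also have "\<dots> = full_state n \<alpha>"
    using Union_cells[OF assms(1), of "2*n"] by (simp add: full_state_def)
  finally show ?thesis
    using assms(2) unfolding potential_states_def mem_Collect_eq
    by (intro exI[of _ 0] exI[of _ "2*n"]) simp
qed

lemma potential_state_props:
  assumes "admissible c n \<alpha>" "q \<in> potential_states n \<alpha>"
  shows "q \<in> sets borel" "q \<subseteq> full_state n \<alpha>" "measure lborel q > 0"
proof -
  obtain i k where q: "q = (\<Union>j\<in>{..<k}. cell \<alpha> ((i + j) mod (2*n) + 1))"
    and ik: "i < 2*n" "k \<in> {1..2*n}"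
    using assms(2) by (auto simp: potential_states_def)
  show b: "q \<in> sets borel" unfolding q cell_def by auto
  have idx: "1 \<le> m mod (2*n) + 1 \<and> m mod (2*n) + 1 \<le> 2*n" for m
    using ik by (simp add: Suc_le_eq)
  have sub: "cell \<alpha> (m mod (2*n) + 1) \<subseteq> full_state n \<alpha>" for m
    using idx[of m] admissible_mono[OF assms(1), of 1 "m mod (2*n) + 1"]
      admissible_mono[OF assms(1), of "m mod (2*n) + 2" "2*n + 1"]
    by (auto simp: cell_def full_state_def)
  show qs: "q \<subseteq> full_state n \<alpha>" unfolding q using sub by auto
  have "0 < measure lborel (cell \<alpha> (i mod (2*n) + 1))"
    using admissible_strict_mono[OF assms(1), of "i mod (2*n) + 1" "i mod (2*n) + 2"] idx[of i]
    by (simp add: cell_def)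
  also have "\<dots> \<le> measure lborel q"
  proof (rule measure_mono_fmeasurable)
    show "cell \<alpha> (i mod (2*n) + 1) \<subseteq> q"
      unfolding q using ik by (intro UN_upper[of 0, THEN order_trans[rotated]]) auto
    show "q \<in> fmeasurable lborel"
    proof (rule fmeasurableI2)
      show "full_state n \<alpha> \<in> fmeasurable lborel"
        using admissible_mono[OF assms(1), of 1 "2*n + 1"]
        by (auto simp: full_state_def fmeasurable_def)
    qed (use b qs in auto)
  qed (auto simp: cell_def)
  finally show "measure lborel q > 0" .
qed

lemma half_part_disjoint_cover:
  assumes "admissible c n \<alpha>" "s (beta (\<alpha> 2)) \<in> {-1, 1}" "q \<subseteq> full_state n \<alpha>"
  shows "half_part s n \<alpha> 1 q \<inter> half_part s n \<alpha> (-1) q = {}"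
    "half_part s n \<alpha> 1 q \<union> half_part s n \<alpha> (-1) q = q"
proof -
  have "\<alpha> 1 \<le> \<alpha> (n + 1)" "\<alpha> (n + 1) \<le> \<alpha> (2*n + 1)"
    using assms(1) by (auto simp: admissible_def)
  then have d: "{\<alpha> 1 ..< \<alpha> (n + 1)} \<inter> {\<alpha> (n + 1) ..< \<alpha> (2*n + 1)} = {}"
    and u: "{\<alpha> 1 ..< \<alpha> (n + 1)} \<union> {\<alpha> (n + 1) ..< \<alpha> (2*n + 1)} = full_state n \<alpha>"
    by (auto simp: full_state_def)
  show "half_part s n \<alpha> 1 q \<inter> half_part s n \<alpha> (-1) q = {}"
    using assms(2) d unfolding half_part_def by auto
  show "half_part s n \<alpha> 1 q \<union> half_part s n \<alpha> (-1) q = q"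
    using assms(2,3) unfolding u[symmetric] half_part_def by auto
qed

lemma ghat_minus_one:
  assumes "admissible c n \<alpha>" "s (beta (\<alpha> 2)) \<in> {-1, 1}" "q \<in> potential_states n \<alpha>"
  shows "ghat s n \<alpha> q = -1 \<longleftrightarrow>
    q = half_part s n \<alpha> (-1) q \<or>
    measure lborel (half_part s n \<alpha> 1 q) < measure lborel (half_part s n \<alpha> (-1) q)"
proof -
  note p = potential_state_props[OF assms(1,3)]
  note h = half_part_disjoint_cover[of c n \<alpha> s q, OF assms(1,2) p(2)]
  have "half_part s n \<alpha> (-1) q = {}" if "q = half_part s n \<alpha> 1 q" using h that by blast
  moreover have "half_part s n \<alpha> 1 q = {}" if "q = half_part s n \<alpha> (-1) q" using h that by blast
  ultimately show ?thesis using p(3) by (auto simp: ghat_def)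
qed

lemma half_part_not_closed:
  assumes "admissible c n \<alpha>" "0 < n" "s (beta (\<alpha> 2)) \<in> {-1, 1}"
  shows "\<exists>q\<in>potential_states n \<alpha>. \<exists>y\<in>{-1, 1}. half_part s n \<alpha> y q \<notin> potential_states n \<alpha>"
proof (intro bexI)
  let ?q = "cell \<alpha> 1" and ?y = "- s (beta (\<alpha> 2))"
  have "\<alpha> 2 \<le> \<alpha> (n + 1)" using assms(2) by (intro admissible_mono[OF assms(1)]) auto
  then have "half_part s n \<alpha> ?y ?q = {}"
    using assms(3) by (auto simp: half_part_def cell_def numeral_2_eq_2)
  then show "half_part s n \<alpha> ?y ?q \<notin> potential_states n \<alpha>"
    using potential_state_props(3)[OF assms(1), of "{}"] by auto
  show "?y \<in> {-1, 1}" using assms(3) by auto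
  show "?q \<in> potential_states n \<alpha>"
    unfolding potential_states_def mem_Collect_eq using assms(2)
    by (intro exI[of _ 0] exI[of _ 1]) (simp add: lessThan_Suc)
qed

lemma norm_beta: "norm (beta \<theta>) = 1"
  by (simp add: beta_def norm_vec_def L2_set_def sum_2)

lemma hhat_real:
  assumes "plant f c s" "u \<in> {0, 1}" "q \<noteq> {}" "\<And>\<theta>. \<theta> \<in> q \<Longrightarrow> f u (beta \<theta>) \<noteq> 0"
  shows "bdd_above ((\<lambda>\<theta>. ln (norm (f u (beta \<theta>)))) ` q)"
    "hhat f q u = ereal (SUP \<theta>\<in>q. ln (norm (f u (beta \<theta>))))"
proof -
  have "continuous_on (sphere 0 1) (f u)"
    using assms(1,2) by (auto simp: plant_def intro: continuous_on_subset)
  then have "bounded (f u ` sphere 0 1)"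
    by (intro compact_imp_bounded compact_continuous_image) auto
  then obtain B where B: "\<And>x. x \<in> sphere 0 1 \<Longrightarrow> norm (f u x) \<le> B"
    unfolding bounded_iff by blast
  show bdd: "bdd_above ((\<lambda>\<theta>. ln (norm (f u (beta \<theta>)))) ` q)"
  proof (rule bdd_aboveI2)
    fix \<theta> assume t: "\<theta> \<in> q"
    have "norm (f u (beta \<theta>)) \<le> B" by (rule B) (simp add: norm_beta)
    moreover have "0 < norm (f u (beta \<theta>))" using assms(4)[OF t] by simp
    ultimately show "ln (norm (f u (beta \<theta>))) \<le> ln B"
      by (intro ln_mono) auto
  qed
  have "hhat f q u = (SUP \<theta>\<in>q. ereal (ln (norm (f u (beta \<theta>)))))"
    unfolding hhat_def using assms(4) by (intro SUP_cong) (auto simp: elog_def)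
  also have "\<dots> = ereal (SUP \<theta>\<in>q. ln (norm (f u (beta \<theta>))))"
  proof (rule ereal_SUP[symmetric])
    obtain \<theta>0 where t0: "\<theta>0 \<in> q" using assms(3) by auto
    have "(SUP \<theta>\<in>q. ereal (ln (norm (f u (beta \<theta>))))) \<le> ereal (SUP \<theta>\<in>q. ln (norm (f u (beta \<theta>))))"
      by (intro SUP_least) (auto intro: cSUP_upper[OF _ bdd])
    moreover have "ereal (ln (norm (f u (beta \<theta>0)))) \<le> (SUP \<theta>\<in>q. ereal (ln (norm (f u (beta \<theta>)))))"
      using t0 by (rule SUP_upper)
    ultimately show "\<bar>SUP \<theta>\<in>q. ereal (ln (norm (f u (beta \<theta>))))\<bar> \<noteq> \<infinity>" by auto
  qed
  finally show "hhat f q u = ereal (SUP \<theta>\<in>q. ln (norm (f u (beta \<theta>))))" .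
qed

end

theory Submission
  imports Defs
begin

text \<open>The machine over-approximates the angle of the plant state. The natural invariant is that
  the angle \<open>\<theta>(t)\<close> of \<open>x(t)\<close> lies in \<open>q(t)\<close>: the machine sees the true sensor value \<open>y(t)\<close>
  (since \<open>\<Delta>\<close> sends exactly the information whether \<open>M\<close> guessed it), so \<open>\<P>\<^sub>y\<close> keeps the half
  circle that contains \<open>\<theta>(t)\<close>, the transition map keeps all cells that the image of this half
  meets, and \<open>v(t) = log \<parallel>f\<^sub>u(\<beta>(\<theta>(t)))\<parallel>\<close> is one of the numbers whose supremum is
  \<open>vhat(t)\<close>.

  This argument needs \<open>\<P>\<^sub>1\<close> and \<open>\<P>\<^sub>-\<^sub>1\<close> to be assigned to the correct halves, which is decided
  by the sensor value at \<open>\<beta>(\<alpha>\<^sub>2)\<close>. For \<open>n = 1\<close> the point \<open>\<beta>(\<alpha>\<^sub>2)\<close> is the antipode of \<open>\<beta>(\<alpha>\<^sub>1)\<close>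
  and the two halves come out interchanged. The bound survives because \<open>f\<^sub>u\<close> is odd: the machine
  then follows \<open>-x(t)\<close> in place of \<open>x(t)\<close>, and both have the same performance output. Hence
  the invariant (\<open>machine_tracks_plant\<close>) is that an angle of \<open>\<sigma> x(t)\<close> lies in \<open>q(t)\<close>, where the
  sign \<open>\<sigma>\<close> is \<open>1\<close> if the halves are labelled correctly and \<open>-1\<close> otherwise
  (\<open>half_part_retains_angle\<close>). It covers every \<open>n\<close> without a case distinction.\<close>

section \<open>The sensor and the line where it switches\<close>

text \<open>The factor \<open>c \<bullet> \<beta>(\<alpha>\<^sub>1 + \<pi>/2)\<close> is \<open>\<plusminus>\<parallel>c\<parallel>\<close>. Its sign is the sensor value on the open half circle
  that starts at the angle \<open>\<alpha>\<^sub>1\<close> of the line \<open>c' x = 0\<close>.\<close>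

lemma inner_beta_line_angle:
  "c \<bullet> beta (line_angle c + \<delta>) = sin \<delta> * (c \<bullet> beta (line_angle c + pi / 2))"
proof -
  have "c $ 1 * cos (line_angle c) + c $ 2 * sin (line_angle c) = 0"
    using line_angle_props(3)[of c] by (simp add: beta_def inner_vec_def sum_2)
  then have "cos \<delta> * (c $ 1 * cos (line_angle c) + c $ 2 * sin (line_angle c)) = 0" by simp
  then show ?thesis
    by (simp add: beta_def inner_vec_def sum_2 cos_add sin_add algebra_simps)
qed

lemma inner_beta_normal_nonzero:
  assumes "c \<noteq> 0"
  shows "c \<bullet> beta (line_angle c + pi / 2) \<noteq> 0"
proof
  assume K: "c \<bullet> beta (line_angle c + pi / 2) = 0"
  let ?a = "line_angle c"
  have 1: "c $ 1 * cos ?a + c $ 2 * sin ?a = 0"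
    using line_angle_props(3)[of c] by (simp add: beta_def inner_vec_def sum_2)
  have 2: "c $ 2 * cos ?a - c $ 1 * sin ?a = 0"
    using K by (simp add: beta_def inner_vec_def sum_2 cos_add sin_add)
  have "(c $ 1)\<^sup>2 + (c $ 2)\<^sup>2 = ((c $ 1)\<^sup>2 + (c $ 2)\<^sup>2) * ((cos ?a)\<^sup>2 + (sin ?a)\<^sup>2)" by simp
  also have "\<dots> = (c $ 1 * cos ?a + c $ 2 * sin ?a)\<^sup>2 + (c $ 2 * cos ?a - c $ 1 * sin ?a)\<^sup>2"
    by algebra
  also have "\<dots> = 0" using 1 2 by simp
  finally have "c $ 1 = 0" "c $ 2 = 0" by (simp_all add: sum_power2_eq_zero_iff)
  then have "c = 0" by (simp add: vec_eq_iff forall_2)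
  with assms show False by simp
qed

lemma orthogonal_in_plane_imp_parallel:
  fixes c d x :: "real ^ 2"
  assumes "c \<noteq> 0" "d \<noteq> 0" "c \<bullet> d = 0" "c \<bullet> x = 0"
  obtains a where "x = a *\<^sub>R d"
proof -
  have d: "c $ 1 * d $ 1 + c $ 2 * d $ 2 = 0" and x: "c $ 1 * x $ 1 + c $ 2 * x $ 2 = 0"
    using assms(3,4) by (simp_all add: inner_vec_def sum_2)
  have "c $ 1 * (x $ 1 * d $ 2 - x $ 2 * d $ 1) = 0" "c $ 2 * (x $ 1 * d $ 2 - x $ 2 * d $ 1) = 0"
    using d x by algebra+
  moreover have "c $ 1 \<noteq> 0 \<or> c $ 2 \<noteq> 0" using assms(1) by (auto simp: vec_eq_iff forall_2)
  ultimately have det: "x $ 1 * d $ 2 = x $ 2 * d $ 1" by auto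
  have "d $ 1 \<noteq> 0 \<or> d $ 2 \<noteq> 0" using assms(2) by (auto simp: vec_eq_iff forall_2)
  then show ?thesis
  proof
    assume "d $ 1 \<noteq> 0"
    then have "x = (x $ 1 / d $ 1) *\<^sub>R d" using det by (simp add: vec_eq_iff forall_2 field_simps)
    then show ?thesis by (rule that)
  next
    assume "d $ 2 \<noteq> 0"
    then have "x = (x $ 2 / d $ 2) *\<^sub>R d" using det by (simp add: vec_eq_iff forall_2 field_simps)
    then show ?thesis by (rule that)
  qed
qed

text \<open>On the line \<open>c' x = 0\<close> this is the requirement that the two opposite rays get opposite
  values.\<close>

lemma sensor_odd:
  assumes "sensor c s" "c \<noteq> 0" "x \<noteq> 0"
  shows "s (- x) = - s x"
proof (cases "c \<bullet> x = 0")
  case False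
  then have "real_of_int (s (- x)) = sgn (c \<bullet> (- x))" "real_of_int (s x) = sgn (c \<bullet> x)"
    using assms(1) by (auto simp: sensor_def)
  then have "real_of_int (s (- x)) = real_of_int (- s x)" by (simp add: sgn_minus)
  then show ?thesis by linarith
next
  case True
  obtain d where d: "d \<noteq> 0" "c \<bullet> d = 0"
    and ray: "\<And>a. a > 0 \<Longrightarrow> s (a *\<^sub>R d) = 1 \<and> s (- (a *\<^sub>R d)) = -1"
    using assms(1) unfolding sensor_def by blast
  obtain a where x: "x = a *\<^sub>R d" using orthogonal_in_plane_imp_parallel[OF assms(2) d True] .
  with assms(3) have "a > 0 \<or> - a > 0" by auto
  then show ?thesis using ray[of a] ray[of "- a"] by (auto simp: x)
qed

section \<open>Polar angles\<close>

lemma beta_add_pi: "beta (\<theta> + pi) = - beta \<theta>"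
  by (simp add: beta_def vec_eq_iff forall_2)

lemma polar_angle_add_pi: "polar_angle x (\<theta> + pi) \<longleftrightarrow> polar_angle (- x) \<theta>"
  by (simp add: polar_angle_def beta_add_pi) (metis minus_equation_iff)

lemma polar_angle_beta: "polar_angle (beta \<theta>) \<theta>"
  using norm_beta[of \<theta>] by (auto simp: polar_angle_def)

lemma ex_polar_angle:
  assumes "x \<noteq> 0" "0 \<le> a" "a < 2 * pi"
  obtains \<theta> where "polar_angle x \<theta>" "a \<le> \<theta>" "\<theta> < a + 2 * pi"
proof -
  have n: "(norm x)\<^sup>2 = (x $ 1)\<^sup>2 + (x $ 2)\<^sup>2"
    by (simp add: norm_vec_def L2_set_def sum_2)
  have "(x $ 1 / norm x)\<^sup>2 + (x $ 2 / norm x)\<^sup>2 = ((x $ 1)\<^sup>2 + (x $ 2)\<^sup>2) / (norm x)\<^sup>2"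
    by (simp only: power_divide add_divide_distrib)
  also have "\<dots> = 1" unfolding n[symmetric] using assms(1) by simp
  finally have "(x $ 1 / norm x)\<^sup>2 + (x $ 2 / norm x)\<^sup>2 = 1" .
  then obtain t where t: "0 \<le> t" "t < 2 * pi" "x $ 1 / norm x = cos t" "x $ 2 / norm x = sin t"
    using sincos_total_2pi by blast
  have xt: "x $ 1 = norm x * cos t" "x $ 2 = norm x * sin t"
    using assms(1) unfolding t(3,4)[symmetric] by simp_all
  have "x = norm x *\<^sub>R beta t"
    unfolding vec_eq_iff forall_2 beta_def vector_scaleR_component vector_2 real_scaleR_def
    using xt by (rule conjI)
  moreover have "beta (t + 2 * pi) = beta t" by (simp add: beta_def)
  ultimately have p: "polar_angle x t" "polar_angle x (t + 2 * pi)"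
    using assms(1) unfolding polar_angle_def by simp_all
  show ?thesis
  proof (cases "a \<le> t")
    case True
    then show ?thesis using that[OF p(1)] t assms by simp
  next
    case False
    then show ?thesis using that[OF p(2)] t assms by simp
  qed
qed

section \<open>Sensor values on the two half circles\<close>

text \<open>In the open half circle the sign of \<open>c' x\<close> is constant. The ray at angle \<open>\<alpha>\<^sub>1\<close> lies on the
  line \<open>c' x = 0\<close>, where the sign leaves the sensor value open; there the output condition on the
  partition transfers the value from the interior of the first cell.\<close>

lemma sensor_on_first_half:
  assumes "plant f c s" "n > 0" "admissible c n \<alpha>" "output_partition s n \<alpha>"
    and "polar_angle x \<theta>" "\<alpha> 1 \<le> \<theta>" "\<theta> < \<alpha> (n + 1)"
  shows "real_of_int (s x) = sgn (c \<bullet> beta (\<alpha> 1 + pi / 2))"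
proof -
  have al: "\<alpha> 1 = line_angle c" "\<alpha> (n + 1) = \<alpha> 1 + pi" using assms(3) by (auto simp: admissible_def)
  have sgn_s: "real_of_int (s z) = sgn (c \<bullet> z)" if "c \<bullet> z \<noteq> 0" for z
    using assms(1) that by (auto simp: plant_def sensor_def)
  have K: "c \<bullet> beta (\<alpha> 1 + pi / 2) \<noteq> 0"
    using inner_beta_normal_nonzero assms(1) al by (simp add: plant_def)
  have interior: "real_of_int (s z) = sgn (c \<bullet> beta (\<alpha> 1 + pi / 2))"
    if "polar_angle z \<phi>" "\<alpha> 1 < \<phi>" "\<phi> < \<alpha> 1 + pi" for z \<phi>
  proof -
    have z: "z = norm z *\<^sub>R beta \<phi>" "0 < norm z" using that(1) by (auto simp: polar_angle_def)
    have sin: "0 < sin (\<phi> - \<alpha> 1)" using that by (intro sin_gt_zero) auto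
    have "c \<bullet> z = norm z * (sin (\<phi> - \<alpha> 1) * (c \<bullet> beta (\<alpha> 1 + pi / 2)))"
      using inner_beta_line_angle[of c "\<phi> - \<alpha> 1"] al by (subst z(1)) simp
    then have "sgn (c \<bullet> z) = sgn (c \<bullet> beta (\<alpha> 1 + pi / 2))" "c \<bullet> z \<noteq> 0"
      using sin z(2) K by (simp_all add: sgn_mult)
    then show ?thesis using sgn_s by simp
  qed
  show ?thesis
  proof (cases "\<theta> = \<alpha> 1")
    case False
    then show ?thesis using interior[OF assms(5)] assms(6,7) al by simp
  next
    case True
    have lt: "\<alpha> 1 < \<alpha> (1 + 1)" using assms(2) by (intro admissible_strict_mono[OF assms(3)]) auto
    have le: "\<alpha> (1 + 1) \<le> \<alpha> (n + 1)" using assms(2) by (intro admissible_mono[OF assms(3)]) auto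
    define \<phi> where "\<phi> = (\<alpha> 1 + \<alpha> (1 + 1)) / 2"
    have "\<phi> \<in> cell \<alpha> 1" "\<theta> \<in> cell \<alpha> 1" using lt True by (auto simp: cell_def \<phi>_def)
    moreover have "1 \<in> {1..2*n}" using assms(2) by simp
    ultimately have "s x = s (beta \<phi>)"
      using assms(4,5) polar_angle_beta unfolding output_partition_def by blast
    moreover have "\<alpha> 1 < \<phi>" "\<phi> < \<alpha> 1 + pi"
      using lt le unfolding al(2) \<phi>_def by (auto simp: field_simps)
    ultimately show ?thesis using interior[OF polar_angle_beta, of \<phi>] by simp
  qed
qed

text \<open>The sign \<open>\<sigma>\<close> compares the sensor value on the first half circle with the value at \<open>\<beta>(\<alpha>\<^sub>2)\<close>
  that labels this half in \<open>\<P>\<^sub>y\<close>. If they differ, the labels of both halves are interchanged, and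
  the half selected by the output at \<open>x\<close> is the one that contains the direction of \<open>- x\<close>.\<close>

lemma half_part_retains_angle:
  assumes "plant f c s" "n > 0" "admissible c n \<alpha>" "output_partition s n \<alpha>"
  obtains \<sigma> :: real where "\<sigma> \<in> {-1, 1}"
    and "\<And>x \<theta> q. polar_angle (\<sigma> *\<^sub>R x) \<theta> \<Longrightarrow> \<theta> \<in> q \<Longrightarrow> q \<subseteq> full_state n \<alpha>
      \<Longrightarrow> \<theta> \<in> half_part s n \<alpha> (s x) q"
proof -
  define y1 y2 where "y1 = s (beta (\<alpha> 1))" and "y2 = s (beta (\<alpha> 2))"
  have sen: "sensor c s" and c: "c \<noteq> 0" using assms(1) by (auto simp: plant_def)
  have val: "s z \<in> {-1, 1}" for z using sen by (simp add: sensor_def)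
  have y: "y1 \<in> {-1, 1}" "y2 \<in> {-1, 1}" using val by (simp_all add: y1_def y2_def)
  have al: "\<alpha> (n + 1) = \<alpha> 1 + pi" "\<alpha> (2 * n + 1) = \<alpha> 1 + 2 * pi"
    using assms(3) by (auto simp: admissible_def)
  have first: "s x = y1" if "polar_angle x \<theta>" "\<alpha> 1 \<le> \<theta>" "\<theta> < \<alpha> (n + 1)" for x \<theta>
    using sensor_on_first_half[OF assms that]
      sensor_on_first_half[OF assms polar_angle_beta, of "\<alpha> 1"] al by (simp add: y1_def)
  have second: "s x = - y1"
    if "polar_angle x \<theta>" "\<alpha> (n + 1) \<le> \<theta>" "\<theta> < \<alpha> (2 * n + 1)" for x \<theta>
  proof -
    have "polar_angle (- x) (\<theta> - pi)" using that(1) polar_angle_add_pi[of x "\<theta> - pi"] by simp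
    then have "s (- x) = y1" by (rule first) (use that al in auto)
    moreover have "x \<noteq> 0" using that(1) by (simp add: polar_angle_def)
    ultimately show ?thesis using sensor_odd[OF sen c] by force
  qed
  define \<sigma> :: real where "\<sigma> = (if y1 = y2 then 1 else -1)"
  show ?thesis
  proof (rule that)
    show "\<sigma> \<in> {-1, 1}" by (simp add: \<sigma>_def)
  next
    fix x \<theta> q
    assume p: "polar_angle (\<sigma> *\<^sub>R x) \<theta>" and q: "\<theta> \<in> q" "q \<subseteq> full_state n \<alpha>"
    have "x \<noteq> 0" using p by (auto simp: polar_angle_def)
    then have s: "s (\<sigma> *\<^sub>R x) = (if y1 = y2 then s x else - s x)"
      using sensor_odd[OF sen c] by (simp add: \<sigma>_def)
    have r: "\<alpha> 1 \<le> \<theta>" "\<theta> < \<alpha> (2 * n + 1)" using q by (auto simp: full_state_def)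
    show "\<theta> \<in> half_part s n \<alpha> (s x) q"
    proof (cases "\<theta> < \<alpha> (n + 1)")
      case True
      then have "s x = y2" using first[OF p] r s y by (auto split: if_splits)
      then show ?thesis using True r q by (simp add: half_part_def y2_def)
    next
      case False
      then have "s x \<noteq> y2" using second[OF p] r s y by (auto split: if_splits)
      then show ?thesis using False r q by (auto simp: half_part_def y2_def)
    qed
  qed
qed

section \<open>The machine follows the plant\<close>

text \<open>The signal \<open>w\<close> tells \<open>M\<close> whether its guess of the binary sensor value is right, so the copy
  of the machine in \<open>M\<close> is driven by the true sensor output of the plant.\<close>

lemma M_state_interconnection:
  assumes "\<And>x. s x \<in> {-1, 1}"
  shows "M_state f s n \<alpha> q0 u (delta_out f s n \<alpha> x0 q0 u) t =
    mhat_state f s n \<alpha> q0 u (\<lambda>t. s (plant_state f x0 u t)) t"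
proof (induction t)
  case (Suc t)
  have flip: "flip_by (if y = g then 0 else 1) g = y" if "y \<in> {-1, 1}" "g \<in> {-1, 1}" for y g :: int
    using that by (auto simp: flip_by_def)
  have "ghat s n \<alpha> q \<in> {-1, 1}" for q by (simp add: ghat_def)
  note flip_s = flip[OF assms this]
  have "delta_out f s n \<alpha> x0 q0 u t =
      (if s (plant_state f x0 u t) =
         ghat s n \<alpha> (mhat_state f s n \<alpha> q0 u (\<lambda>t. s (plant_state f x0 u t)) t) then 0 else 1)"
    by (simp add: delta_out_def)
  then show ?case by (simp only: M_state.simps mhat_state.simps Suc flip_s)
qed simp

lemma cell_subset_full_state:
  assumes "admissible c n \<alpha>" "i \<in> {1..2*n}"
  shows "cell \<alpha> i \<subseteq> full_state n \<alpha>"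
proof -
  have "\<alpha> 1 \<le> \<alpha> i" "\<alpha> (i + 1) \<le> \<alpha> (2 * n + 1)"
    using assms(2) by (auto intro!: admissible_mono[OF assms(1)])
  then show ?thesis by (auto simp: cell_def full_state_def)
qed

lemma in_fhatI:
  assumes "admissible c n \<alpha>" "\<theta> \<in> half_part s n \<alpha> y q" "polar_angle (f u (beta \<theta>)) \<phi>"
    and "\<phi> \<in> full_state n \<alpha>"
  shows "\<phi> \<in> fhat f s n \<alpha> q u y"
proof -
  have "\<phi> \<in> (\<Union>j\<in>{..<2*n}. cell \<alpha> (j + 1))"
    using Union_cells[OF assms(1), of "2*n"] assms(4) by (simp add: full_state_def)
  then obtain j where j: "j < 2*n" "\<phi> \<in> cell \<alpha> (j + 1)" by auto
  have "\<phi> \<in> image_angles f u (half_part s n \<alpha> y q)"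
    using assms(2,3) by (auto simp: image_angles_def)
  with j have "j + 1 \<in> hit_cells f n \<alpha> u (half_part s n \<alpha> y q)" by (auto simp: hit_cells_def)
  with j(2) show ?thesis unfolding fhat_def by blast
qed

lemma mhat_state_subset_full_state:
  assumes "admissible c n \<alpha>" "q0 = full_state n \<alpha>"
  shows "mhat_state f s n \<alpha> q0 u y t \<subseteq> full_state n \<alpha>"
  using assms cell_subset_full_state[OF assms(1)]
  by (cases t) (auto simp: fhat_def hit_cells_def)

lemma homogeneous_at_polar_angle:
  assumes "\<And>a x. F (a *\<^sub>R x) = a *\<^sub>R F x" "polar_angle (\<sigma> *\<^sub>R x) \<theta>"
  shows "\<sigma> *\<^sub>R F x = norm (\<sigma> *\<^sub>R x) *\<^sub>R F (beta \<theta>)"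
proof -
  have "\<sigma> *\<^sub>R x = norm (\<sigma> *\<^sub>R x) *\<^sub>R beta \<theta>" using assms(2) unfolding polar_angle_def by blast
  then have "F (\<sigma> *\<^sub>R x) = F (norm (\<sigma> *\<^sub>R x) *\<^sub>R beta \<theta>)" by (rule arg_cong)
  then show ?thesis unfolding assms(1) .
qed

lemma polar_angle_positive_scale:
  assumes "polar_angle (r *\<^sub>R x) \<theta>" "r > 0"
  shows "polar_angle x \<theta>"
proof -
  have "r *\<^sub>R x = norm (r *\<^sub>R x) *\<^sub>R beta \<theta>" using assms(1) unfolding polar_angle_def by blast
  also have "\<dots> = r *\<^sub>R (norm x *\<^sub>R beta \<theta>)" using assms(2) by simp
  finally have "x = norm x *\<^sub>R beta \<theta>" using assms(2) by (metis scaleR_cancel_left less_irrefl)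
  moreover have "x \<noteq> 0" using assms(1) by (auto simp: polar_angle_def)
  ultimately show ?thesis unfolding polar_angle_def by blast
qed

text \<open>The sign \<open>\<sigma>\<close> survives the transition because \<open>f\<^sub>u\<close> is odd. A zero plant state has no angle
  and never becomes nonzero again, so the claim is restricted to nonzero states.\<close>

lemma machine_tracks_plant:
  assumes hom: "\<And>t a x. f (u t) (a *\<^sub>R x) = a *\<^sub>R f (u t) x"
    and adm: "admissible c n \<alpha>" and q0: "q0 = full_state n \<alpha>" and sigma: "\<sigma> \<in> {-1, 1}"
    and retain: "\<And>x \<theta> q. polar_angle (\<sigma> *\<^sub>R x) \<theta> \<Longrightarrow> \<theta> \<in> q \<Longrightarrow> q \<subseteq> full_state n \<alpha>
      \<Longrightarrow> \<theta> \<in> half_part s n \<alpha> (s x) q"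
    and nz: "plant_state f x0 u t \<noteq> 0"
  shows "\<exists>\<theta> \<in> mhat_state f s n \<alpha> q0 u (\<lambda>t. s (plant_state f x0 u t)) t.
    polar_angle (\<sigma> *\<^sub>R plant_state f x0 u t) \<theta>"
proof -
  have angle: "\<exists>\<theta> \<in> full_state n \<alpha>. polar_angle (\<sigma> *\<^sub>R x) \<theta>" if "x \<noteq> 0" for x
  proof -
    have "0 \<le> \<alpha> 1" "\<alpha> 1 < 2 * pi" "\<alpha> (2 * n + 1) = \<alpha> 1 + 2 * pi"
      using adm line_angle_props(1,2)[of c] by (auto simp: admissible_def)
    moreover have "\<sigma> *\<^sub>R x \<noteq> 0" using that sigma by auto
    ultimately show ?thesis
      using ex_polar_angle[of "\<sigma> *\<^sub>R x" "\<alpha> 1"] by (fastforce simp: full_state_def)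
  qed
  show ?thesis using nz
  proof (induction t)
    case 0
    then show ?case using angle q0 by simp
  next
    case (Suc t)
    let ?x = "plant_state f x0 u" and ?q = "mhat_state f s n \<alpha> q0 u (\<lambda>t. s (plant_state f x0 u t))"
    have "f (u t) 0 = 0" using hom[of t 0 0] by simp
    with Suc.prems have nz: "?x t \<noteq> 0" by auto
    then obtain \<theta> where th: "\<theta> \<in> ?q t" "polar_angle (\<sigma> *\<^sub>R ?x t) \<theta>" using Suc.IH by blast
    obtain \<phi> where ph: "\<phi> \<in> full_state n \<alpha>" "polar_angle (\<sigma> *\<^sub>R ?x (Suc t)) \<phi>"
      using angle Suc.prems by blast
    have "\<sigma> *\<^sub>R ?x (Suc t) = norm (\<sigma> *\<^sub>R ?x t) *\<^sub>R f (u t) (beta \<theta>)"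
      using homogeneous_at_polar_angle[of "f (u t)", OF hom th(2)] by simp
    with ph(2) have "polar_angle (norm (\<sigma> *\<^sub>R ?x t) *\<^sub>R f (u t) (beta \<theta>)) \<phi>" by (simp only:)
    moreover have "0 < norm (\<sigma> *\<^sub>R ?x t)" using nz sigma by auto
    ultimately have "polar_angle (f (u t) (beta \<theta>)) \<phi>" by (rule polar_angle_positive_scale)
    moreover have "\<theta> \<in> half_part s n \<alpha> (s (?x t)) (?q t)"
      using retain[OF th(2,1)] mhat_state_subset_full_state[OF adm q0] .
    ultimately have "\<phi> \<in> ?q (Suc t)" using in_fhatI[OF adm] ph(1) by simp
    with ph(2) show ?case by blast
  qed
qed

section \<open>The bound on the performance output\<close>

theorem lemma1:
  fixes f :: "nat \<Rightarrow> real ^ 2 \<Rightarrow> real ^ 2" and c :: "real ^ 2" and s :: "real ^ 2 \<Rightarrow> int"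
    and n :: nat and \<alpha> :: "nat \<Rightarrow> real"
    and u :: "nat \<Rightarrow> nat" and x0 :: "real ^ 2" and q0 :: "real set"
  assumes "plant f c s"
    and "n > 0"
    and "admissible c n \<alpha>"
    and "output_partition s n \<alpha>"
    and "q0 = full_state n \<alpha>"
    and "\<And>t. u t \<in> {0, 1}"
  shows "\<forall>t. M_Delta_vhat f s n \<alpha> x0 q0 u t \<ge> perf f x0 u t"
proof
  fix t
  let ?x = "plant_state f x0 u" and ?q = "mhat_state f s n \<alpha> q0 u (\<lambda>t. s (plant_state f x0 u t))"
  have hom: "f (u t) (a *\<^sub>R x) = a *\<^sub>R f (u t) x" for t a x
    using assms(1) assms(6)[of t] unfolding plant_def by blast
  have "s x \<in> {-1, 1}" for x using assms(1) by (simp add: plant_def sensor_def)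
  then have vhat: "M_Delta_vhat f s n \<alpha> x0 q0 u t = hhat f (?q t) (u t)"
    by (simp add: M_Delta_vhat_def M_vhat_def M_state_interconnection)
  show "M_Delta_vhat f s n \<alpha> x0 q0 u t \<ge> perf f x0 u t"
  proof (cases "?x t = 0")
    case True
    then show ?thesis by (simp add: perf_def elog_def)
  next
    case False
    obtain \<sigma> :: real where sg: "\<sigma> \<in> {-1, 1}" and retain:
      "\<And>x \<theta> q. polar_angle (\<sigma> *\<^sub>R x) \<theta> \<Longrightarrow> \<theta> \<in> q \<Longrightarrow> q \<subseteq> full_state n \<alpha>
        \<Longrightarrow> \<theta> \<in> half_part s n \<alpha> (s x) q"
      using half_part_retains_angle[OF assms(1-4)] by blast
    obtain \<theta> where th: "\<theta> \<in> ?q t" "polar_angle (\<sigma> *\<^sub>R ?x t) \<theta>"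
      using machine_tracks_plant[OF hom assms(3,5) sg retain False] by blast
    have "\<bar>\<sigma>\<bar> = 1" using sg by auto
    then have "norm (?x (Suc t)) = norm (?x t) * norm (f (u t) (beta \<theta>))"
      using arg_cong[OF homogeneous_at_polar_angle[of "f (u t)", OF hom th(2)], of norm] by simp
    then have "perf f x0 u t = elog (norm (f (u t) (beta \<theta>)))"
      using False by (simp add: perf_def)
    also have "\<dots> \<le> hhat f (?q t) (u t)" unfolding hhat_def using th(1) by (rule SUP_upper)
    finally show ?thesis using vhat by simp
  qed
qed

end
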